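(* For any positive integers $n,p$, one has $\mathcal{E}_{n,p}\ge\sqrt{n}$, i.e. $E_{n,p}(\underline{u})\ge\sqrt{n}$ for every $\underline{u}=(u_1,\dots,u_n)\in(S^{p-1})^n$. Equality $E_{n,p}(\underline{u})=\sqrt{n}$ holds if and only if $n\le p$ and all the $u_i$ are orthogonal to each other.
   Context: $S^{p-1}=\{v\in\mathbb{R}^p:\|v\|=1\}$ with the Euclidean norm. For $\underline{u}=(u_1,\dots,u_n)\in(S^{p-1})^n$ the energy is $E_{n,p}(\underline{u})=\max_{v\in S^{p-1}}\sum_{i=1}^n|u_i\cdot v|$, and the minimal energy is $\mathcal{E}_{n,p}=\inf_{\underline{u}\in(S^{p-1})^n}E_{n,p}(\underline{u})$. *)

theory Defs
  imports "HOL-Analysis.Analysis"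
begin

text \<open>The sphere \<open>S\<^sup>p\<^sup>-\<^sup>1\<close> is \<^term>\<open>sphere (0 :: real ^ 'p) 1\<close> with \<open>p = CARD('p)\<close>.
  A tuple in \<open>(S\<^sup>p\<^sup>-\<^sup>1)\<^sup>n\<close> is a function on the index set \<^term>\<open>{1..n}\<close>, extended by
  \<^const>\<open>undefined\<close> outside of it.\<close>

definition sphere_tuples :: "nat \<Rightarrow> (nat \<Rightarrow> real ^ 'p) set" where
  "sphere_tuples n = (\<Pi>\<^sub>E i\<in>{1..n}. sphere 0 1)"

text \<open>The supremum below is a maximum, see \<open>energy_attained\<close> and \<open>energy_upper\<close>.\<close>

definition energy :: "nat \<Rightarrow> (nat \<Rightarrow> real ^ 'p) \<Rightarrow> real" where
  "energy n u = (SUP v\<in>sphere 0 1. \<Sum>i=1..n. \<bar>u i \<bullet> v\<bar>)"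

text \<open>The argument of type \<^typ>\<open>'p itself\<close> only serves to fix the dimension \<open>p = CARD('p)\<close>.\<close>

definition minimal_energy :: "nat \<Rightarrow> 'p::finite itself \<Rightarrow> real" where
  "minimal_energy n p = (INF u\<in>(sphere_tuples n :: (nat \<Rightarrow> real ^ 'p) set). energy n u)"

lemma energy_max:
  fixes u :: "nat \<Rightarrow> real ^ 'p"
  obtains v where "v \<in> sphere 0 1" and "energy n u = (\<Sum>i=1..n. \<bar>u i \<bullet> v\<bar>)"
    and "\<And>w. w \<in> sphere 0 1 \<Longrightarrow> (\<Sum>i=1..n. \<bar>u i \<bullet> w\<bar>) \<le> energy n u"
proof -
  let ?f = "\<lambda>v. \<Sum>i=1..n. \<bar>u i \<bullet> v\<bar>"
  have "axis undefined 1 \<in> sphere (0 :: real ^ 'p) 1"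
    by simp
  then have "sphere (0 :: real ^ 'p) 1 \<noteq> {}"
    by blast
  moreover have "continuous_on (sphere 0 1) ?f"
    by (intro continuous_intros)
  ultimately obtain v where v: "v \<in> sphere 0 1" "\<And>w. w \<in> sphere 0 1 \<Longrightarrow> ?f w \<le> ?f v"
    using continuous_attains_sup[OF compact_sphere] by blast
  have "energy n u = ?f v"
    unfolding energy_def by (rule cSup_eq_maximum) (use v in auto)
  with v that show ?thesis
    by simp
qed

lemma energy_attained:
  fixes u :: "nat \<Rightarrow> real ^ 'p"
  shows "\<exists>v\<in>sphere 0 1. energy n u = (\<Sum>i=1..n. \<bar>u i \<bullet> v\<bar>)"
  by (metis energy_max)

lemma energy_upper:
  fixes u :: "nat \<Rightarrow> real ^ 'p"
  assumes "v \<in> sphere 0 1"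
  shows "(\<Sum>i=1..n. \<bar>u i \<bullet> v\<bar>) \<le> energy n u"
  using assms by (metis energy_max)

end

theory Submission imports Defs begin

text \<open>
  The energy of \<open>u\<close> is the largest norm of a signed sum \<open>w = \<Sum>i. s i *\<^sub>R u i\<close> with
  \<open>s i \<in> {-1, 1}\<close>. Indeed \<open>\<Sum>i. \<bar>u i \<bullet> v\<bar>\<close> is the inner product of \<open>v\<close> with the signed sum
  given by the signs of \<open>u i \<bullet> v\<close>, so it is at most the norm of that sum; conversely, testing
  the energy in the direction of \<open>w\<close> gives at least \<open>norm w\<close>.

  A signed sum of unit vectors can be built greedily: at each step the sign is chosen so that the
  new vector does not point away from the partial sum, and the squared norm grows by at least 1.
  This produces a signed sum of squared norm at least \<open>n\<close>, hence the lower bound \<open>sqrt n\<close>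
  (\<open>greedy_signs\<close>, \<open>norm_signed_sum_le_energy\<close>). If two of the vectors are not orthogonal,
  the construction can begin with these two, and the first step then gains strictly more than 1
  (\<open>signed_sum_not_orthogonal\<close>); so equality forces orthogonality. Conversely, by Pythagoras every
  signed sum of \<open>n\<close> orthogonal unit vectors has norm exactly \<open>sqrt n\<close>. Finally, orthogonal
  unit vectors are linearly independent, which gives \<open>n \<le> p\<close>.
\<close>

section \<open>Signed sums of unit vectors\<close>

lemma norm_add_scaled_unit_sq:
  fixes x y :: "'a::real_inner"
  assumes "norm y = 1" "s \<in> {-1, 1}"
  shows "norm (x + s *\<^sub>R y) ^ 2 = norm x ^ 2 + 1 + 2 * s * (x \<bullet> y)"
  using assms by (auto simp: power2_norm_eq_inner inner_commute norm_eq_1 algebra_simps)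

text \<open>Choosing the sign of the inner product with the partial sum makes the cross term nonnegative.
  The arbitrary starting vector \<open>x\<close> lets a favourable beginning of the sum be prescribed.\<close>

lemma greedy_signs:
  fixes u :: "'i \<Rightarrow> 'a::real_inner"
  assumes "finite I" "\<And>i. i \<in> I \<Longrightarrow> norm (u i) = 1"
  shows "\<exists>s. (\<forall>i. s i \<in> {-1, 1}) \<and>
    norm (x + (\<Sum>i\<in>I. s i *\<^sub>R u i)) ^ 2 \<ge> norm x ^ 2 + real (card I)"
  using assms
proof (induction I rule: finite_induct)
  case empty
  show ?case by (rule exI[of _ "\<lambda>_. 1"]) simp
next
  case (insert j I)
  then obtain s where s: "\<forall>i. s i \<in> {-1, 1}"
    and le: "norm x ^ 2 + real (card I) \<le> norm (x + (\<Sum>i\<in>I. s i *\<^sub>R u i)) ^ 2"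
    by auto
  define w where "w = x + (\<Sum>i\<in>I. s i *\<^sub>R u i)"
  define e :: real where "e = (if w \<bullet> u j \<ge> 0 then 1 else -1)"
  have e: "e \<in> {-1, 1}" "e * (w \<bullet> u j) \<ge> 0"
    by (auto simp: e_def)
  have "(\<Sum>i\<in>I. (s(j := e)) i *\<^sub>R u i) = (\<Sum>i\<in>I. s i *\<^sub>R u i)"
    using insert.hyps by (intro sum.cong) auto
  then have "x + (\<Sum>i\<in>insert j I. (s(j := e)) i *\<^sub>R u i) = w + e *\<^sub>R u j"
    using insert.hyps by (simp add: w_def algebra_simps)
  moreover have "norm (w + e *\<^sub>R u j) ^ 2 \<ge> norm x ^ 2 + real (card (insert j I))"
    using norm_add_scaled_unit_sq[of "u j" e w] e le insert.prems insert.hyps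
    by (simp add: w_def[symmetric])
  ultimately show ?case
    using s e by (intro exI[of _ "s(j := e)"]) auto
qed

lemma signed_sum_not_orthogonal:
  fixes u :: "'i \<Rightarrow> 'a::real_inner"
  assumes fin: "finite I" and unit: "\<And>i. i \<in> I \<Longrightarrow> norm (u i) = 1"
    and ij: "i \<in> I" "j \<in> I" "i \<noteq> j" and "\<not> orthogonal (u i) (u j)"
  shows "\<exists>s. (\<forall>k. s k \<in> {-1, 1}) \<and> norm (\<Sum>k\<in>I. s k *\<^sub>R u k) ^ 2 > real (card I)"
proof -
  define e :: real where "e = (if u i \<bullet> u j \<ge> 0 then 1 else -1)"
  have e: "e \<in> {-1, 1}" "e * (u i \<bullet> u j) > 0"
    using assms(6) by (auto simp: e_def orthogonal_def)
  define x where "x = u i + e *\<^sub>R u j"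
  define J where "J = I - {i, j}"
  have x: "norm x ^ 2 > 2"
    using norm_add_scaled_unit_sq[of "u j" e "u i"] e unit ij by (simp add: x_def)
  obtain s where s: "\<forall>k. s k \<in> {-1, 1}"
    and le: "norm x ^ 2 + real (card J) \<le> norm (x + (\<Sum>k\<in>J. s k *\<^sub>R u k)) ^ 2"
    using greedy_signs[of J u x] fin unit by (auto simp: J_def)
  define t where "t = s(i := 1, j := e)"
  have I: "I = insert i (insert j J)" "i \<notin> insert j J" "j \<notin> J" "finite J"
    using ij fin by (auto simp: J_def)
  have "(\<Sum>k\<in>J. t k *\<^sub>R u k) = (\<Sum>k\<in>J. s k *\<^sub>R u k)"
    using I by (intro sum.cong) (auto simp: t_def)
  then have "(\<Sum>k\<in>I. t k *\<^sub>R u k) = x + (\<Sum>k\<in>J. s k *\<^sub>R u k)"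
    using I ij by (simp add: x_def t_def algebra_simps)
  moreover have "real (card I) = 2 + real (card J)"
    using I by simp
  ultimately show ?thesis
    using s e x le by (intro exI[of _ t]) (auto simp: t_def)
qed

lemma norm_signed_sum_orthogonal:
  fixes u :: "'i \<Rightarrow> 'a::real_inner"
  assumes "finite I" "\<And>i. i \<in> I \<Longrightarrow> norm (u i) = 1"
    and orth: "pairwise (\<lambda>i j. orthogonal (u i) (u j)) I" and s: "\<And>i. s i \<in> {-1, 1}"
  shows "norm (\<Sum>i\<in>I. s i *\<^sub>R u i) = sqrt (real (card I))"
proof -
  have "pairwise (\<lambda>i j. orthogonal (s i *\<^sub>R u i) (s j *\<^sub>R u j)) I"
    using orth by (auto simp: pairwise_def orthogonal_def)
  then have "norm (\<Sum>i\<in>I. s i *\<^sub>R u i) ^ 2 = (\<Sum>i\<in>I. norm (s i *\<^sub>R u i) ^ 2)"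
    by (rule norm_sum_Pythagorean[OF assms(1)])
  also have "\<dots> = (\<Sum>i\<in>I. 1)"
  proof (rule sum.cong)
    fix i assume "i \<in> I"
    then show "norm (s i *\<^sub>R u i) ^ 2 = 1"
      using assms(2) s[of i] by auto
  qed simp
  finally show ?thesis
    by (simp add: real_sqrt_unique)
qed

lemma card_orthonormal_family_le:
  fixes u :: "'i \<Rightarrow> 'a::euclidean_space"
  assumes "\<And>i. i \<in> I \<Longrightarrow> norm (u i) = 1"
    and "pairwise (\<lambda>i j. orthogonal (u i) (u j)) I"
  shows "card I \<le> DIM('a)"
proof -
  have "inj_on u I"
  proof (rule inj_onI, rule ccontr)
    fix i j assume *: "i \<in> I" "j \<in> I" "u i = u j" "i \<noteq> j"
    then have "u i \<bullet> u i = 0"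
      using assms(2) by (metis orthogonal_def pairwise_def)
    then show False using assms(1) * by force
  qed
  moreover have "independent (u ` I)"
  proof (rule pairwise_orthogonal_independent)
    show "pairwise orthogonal (u ` I)"
      using assms(2) by (auto simp: pairwise_def)
    show "0 \<notin> u ` I" using assms(1) by force
  qed
  ultimately show ?thesis
    using independent_bound by (metis card_image)
qed

section \<open>The energy as a maximum over signs\<close>

lemma sum_abs_inner_le_energy:
  fixes u :: "nat \<Rightarrow> real ^ 'p"
  shows "(\<Sum>i=1..n. \<bar>u i \<bullet> v\<bar>) \<le> energy n u * norm v"
proof (cases "v = 0")
  case False
  have "(\<Sum>i=1..n. \<bar>u i \<bullet> v\<bar>) / norm v = (\<Sum>i=1..n. \<bar>u i \<bullet> (v /\<^sub>R norm v)\<bar>)"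
    by (simp add: sum_distrib_left abs_mult divide_inverse mult.commute)
  also have "\<dots> \<le> energy n u"
    using False by (intro energy_upper) simp
  finally show ?thesis
    using False by (simp add: field_simps)
qed simp

text \<open>In the direction of the signed sum \<open>w\<close> itself, the sum of \<open>\<bar>u i \<bullet> w\<bar>\<close> is at least
  \<open>w \<bullet> w\<close>.\<close>

lemma norm_signed_sum_le_energy:
  fixes u :: "nat \<Rightarrow> real ^ 'p"
  assumes s: "\<And>i. s i \<in> {-1, 1}"
  shows "norm (\<Sum>i=1..n. s i *\<^sub>R u i) \<le> energy n u"
proof -
  define w where "w = (\<Sum>i=1..n. s i *\<^sub>R u i)"
  have "norm w * norm w = w \<bullet> w"
    by (simp add: dot_square_norm power2_eq_square)
  also have "w \<bullet> w = (\<Sum>i=1..n. s i * (u i \<bullet> w))"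
    by (subst (1) w_def) (simp add: inner_sum_left)
  also have "\<dots> \<le> (\<Sum>i=1..n. \<bar>u i \<bullet> w\<bar>)"
  proof (rule sum_mono)
    fix i show "s i * (u i \<bullet> w) \<le> \<bar>u i \<bullet> w\<bar>"
      using s[of i] by auto
  qed
  also have "\<dots> \<le> energy n u * norm w"
    by (rule sum_abs_inner_le_energy)
  finally have *: "norm w * norm w \<le> energy n u * norm w" .
  have "0 \<le> energy n u"
    using energy_attained[of n u] by (auto intro: sum_nonneg)
  with * show ?thesis
    unfolding w_def[symmetric] by (cases "w = 0") auto
qed

text \<open>At a maximizing direction \<open>v\<close>, the signs of \<open>u i \<bullet> v\<close> turn the energy into an inner product
  of \<open>v\<close> with a signed sum.\<close>

lemma energy_le_norm_signed_sum:
  fixes u :: "nat \<Rightarrow> real ^ 'p"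
  shows "\<exists>s. (\<forall>i. s i \<in> {-1, 1}) \<and> energy n u \<le> norm (\<Sum>i=1..n. s i *\<^sub>R u i)"
proof -
  obtain v where v: "v \<in> sphere 0 1" "energy n u = (\<Sum>i=1..n. \<bar>u i \<bullet> v\<bar>)"
    using energy_attained[of n u] by blast
  define s :: "nat \<Rightarrow> real" where "s = (\<lambda>i. if u i \<bullet> v \<ge> 0 then 1 else -1)"
  have "energy n u = (\<Sum>i=1..n. s i *\<^sub>R u i) \<bullet> v"
    unfolding v(2) inner_sum_left by (intro sum.cong) (auto simp: s_def)
  also have "\<dots> \<le> norm (\<Sum>i=1..n. s i *\<^sub>R u i)"
    using norm_cauchy_schwarz[of "\<Sum>i=1..n. s i *\<^sub>R u i" v] v(1) by simp
  finally show ?thesis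
    by (intro exI[of _ s]) (simp add: s_def)
qed

section \<open>The lower bound and its equality case\<close>

lemma norm_sphere_tuples:
  "u \<in> sphere_tuples n \<Longrightarrow> i \<in> {1..n} \<Longrightarrow> norm (u i) = 1"
  by (auto simp: sphere_tuples_def PiE_def Pi_def)

lemma sphere_tuples_nonempty: "(sphere_tuples n :: (nat \<Rightarrow> real ^ 'p) set) \<noteq> {}"
  by (simp add: sphere_tuples_def PiE_eq_empty_iff)

lemma energy_ge_sqrt:
  fixes u :: "nat \<Rightarrow> real ^ 'p"
  assumes "u \<in> sphere_tuples n"
  shows "energy n u \<ge> sqrt (real n)"
proof -
  obtain s where s: "\<forall>i. s i \<in> {-1, 1}" "real n \<le> norm (\<Sum>i=1..n. s i *\<^sub>R u i) ^ 2"
    using greedy_signs[of "{1..n}" u 0] norm_sphere_tuples[OF assms] by auto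
  then have "sqrt (real n) \<le> norm (\<Sum>i=1..n. s i *\<^sub>R u i)"
    by (intro real_le_lsqrt) auto
  also have "\<dots> \<le> energy n u"
    using s(1) by (intro norm_signed_sum_le_energy) auto
  finally show ?thesis .
qed

lemma energy_gt_sqrt_not_orthogonal:
  fixes u :: "nat \<Rightarrow> real ^ 'p"
  assumes "u \<in> sphere_tuples n" "\<not> pairwise (\<lambda>i j. orthogonal (u i) (u j)) {1..n}"
  shows "energy n u > sqrt (real n)"
proof -
  obtain i j where "i \<in> {1..n}" "j \<in> {1..n}" "i \<noteq> j" "\<not> orthogonal (u i) (u j)"
    using assms(2) unfolding pairwise_def by blast
  then obtain s where s: "\<forall>i. s i \<in> {-1, 1}" "real n < norm (\<Sum>i=1..n. s i *\<^sub>R u i) ^ 2"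
    using signed_sum_not_orthogonal[of "{1..n}" u i j] norm_sphere_tuples[OF assms(1)] by auto
  then have "sqrt (real n) < norm (\<Sum>i=1..n. s i *\<^sub>R u i)"
    by (intro real_less_lsqrt) auto
  also have "\<dots> \<le> energy n u"
    using s(1) by (intro norm_signed_sum_le_energy) auto
  finally show ?thesis .
qed

lemma energy_le_sqrt_orthogonal:
  fixes u :: "nat \<Rightarrow> real ^ 'p"
  assumes "u \<in> sphere_tuples n" "pairwise (\<lambda>i j. orthogonal (u i) (u j)) {1..n}"
  shows "energy n u \<le> sqrt (real n)"
proof -
  obtain s where s: "\<forall>i. s i \<in> {-1, 1}" "energy n u \<le> norm (\<Sum>i=1..n. s i *\<^sub>R u i)"
    using energy_le_norm_signed_sum by blast
  moreover have "norm (\<Sum>i=1..n. s i *\<^sub>R u i) = sqrt (real n)"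
    using norm_signed_sum_orthogonal[of "{1..n}" u s] norm_sphere_tuples[OF assms(1)] assms(2) s(1)
    by simp
  ultimately show ?thesis by simp
qed

theorem proposition2p2:
  fixes n :: nat
  assumes "n > 0"
  shows "minimal_energy n TYPE('p::finite) \<ge> sqrt (real n) \<and>
    (\<forall>u \<in> (sphere_tuples n :: (nat \<Rightarrow> real ^ 'p) set).
      energy n u \<ge> sqrt (real n) \<and>
      (energy n u = sqrt (real n) \<longleftrightarrow>
        n \<le> CARD('p) \<and> pairwise (\<lambda>i j. orthogonal (u i) (u j)) {1..n}))"
proof (intro conjI ballI)
  show "minimal_energy n TYPE('p) \<ge> sqrt (real n)"
    unfolding minimal_energy_def
    by (rule cINF_greatest[OF sphere_tuples_nonempty]) (rule energy_ge_sqrt)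
next
  fix u :: "nat \<Rightarrow> real ^ 'p" assume u: "u \<in> sphere_tuples n"
  show ge: "energy n u \<ge> sqrt (real n)"
    using u by (rule energy_ge_sqrt)
  show "energy n u = sqrt (real n) \<longleftrightarrow>
    n \<le> CARD('p) \<and> pairwise (\<lambda>i j. orthogonal (u i) (u j)) {1..n}"
  proof
    assume "energy n u = sqrt (real n)"
    then have orth: "pairwise (\<lambda>i j. orthogonal (u i) (u j)) {1..n}"
      using energy_gt_sqrt_not_orthogonal[OF u] by force
    moreover have "n \<le> CARD('p)"
      using card_orthonormal_family_le[OF norm_sphere_tuples[OF u] orth] by simp
    ultimately show "n \<le> CARD('p) \<and> pairwise (\<lambda>i j. orthogonal (u i) (u j)) {1..n}"
      by simp
  next
    assume "n \<le> CARD('p) \<and> pairwise (\<lambda>i j. orthogonal (u i) (u j)) {1..n}"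
    then show "energy n u = sqrt (real n)"
      using energy_le_sqrt_orthogonal[OF u] ge by simp
  qed
qed

end
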